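(* Let $n\ge 2$ and $X=\{1,2,\dots,n\}$. Consider the following nondeterministic procedure. Step 1: set $\mathcal{S}_0=\{\emptyset\}$, $\mathcal{S}_1=\{\{1\},\dots,\{n\}\}$, $\mathcal{S}_n=\{X\}$, $\mathcal{S}^*=\mathcal{S}_0\cup\mathcal{S}_1\cup\mathcal{S}_n$, $k=0$. Step 2: if $n-k=2$, stop and output $\mathcal{S}^*$. Step 3: for each $S\in\mathcal{S}_{n-k}$ choose a two-element subset $\delta(S)=\{i_S,j_S\}\subseteq S$ such that $\delta(S)\not\subseteq T$ for every $T\in\mathcal{S}_{n-k}\setminus\{S\}$. Step 4: set $\mathcal{S}_{n-k-1}=\bigcup_{S\in\mathcal{S}_{n-k}}\{S\setminus\{i_S\},\,S\setminus\{j_S\}\}$. Step 5: $k:=k+1$. Step 6: $\mathcal{S}^*:=\mathcal{S}^*\cup\mathcal{S}_{n-k}$ and go to Step 2. Then every output $\mathcal{S}^*$ of this procedure, ordered by inclusion, is a finite super-atomic lattice in $\mathcal{L}(n)$. Moreover, every finite super-atomic lattice in $\mathcal{L}(n)$ is equal to some output $\mathcal{S}^*$ of the procedure (for suitable choices in Step 3).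
   Context: $\mathcal{L}(n)$ denotes the set of finite atomic lattices with $n$ atoms labeled $1,\dots,n$; each such lattice is represented as a family $\mathcal{S}$ of subsets of $\{1,\dots,n\}$, closed under intersection, containing $\emptyset$, $\{1,\dots,n\}$ and all singletons $\{i\}$, ordered by inclusion. A finite atomic lattice is a finite lattice with least element $0$ and greatest element in which every nonzero element is a join of atoms. For an element $p$ of a finite atomic lattice $P$ let $\mathrm{supp}(p)$ be the set of atoms below $p$ and $B_p=\{T\subseteq\mathrm{supp}(p): \bigvee_{b\in T}b=p\}$. $P$ is super-atomic if for every $p\in P$ that is neither $0$ nor an atom, and every $T\in B_p$, there exist exactly two elements $a,b\in T$ with $a\vee b=p$. *)

theory Defs
  imports "HOL-Algebra.Lattice"
begin

definition atoms :: "('a, 'b) gorder_scheme \<Rightarrow> 'a set" where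
  "atoms P = {a \<in> carrier P. a \<noteq> \<bottom>\<^bsub>P\<^esub> \<and>
     (\<forall>x\<in>carrier P. x \<sqsubseteq>\<^bsub>P\<^esub> a \<longrightarrow> x = \<bottom>\<^bsub>P\<^esub> \<or> x = a)}"

definition finite_atomic_lattice :: "('a, 'b) gorder_scheme \<Rightarrow> bool" where
  "finite_atomic_lattice P \<longleftrightarrow> Lattice.bounded_lattice P \<and> finite (carrier P) \<and>
     (\<forall>p\<in>carrier P. p \<noteq> \<bottom>\<^bsub>P\<^esub> \<longrightarrow> (\<exists>T\<subseteq>atoms P. p = \<Squnion>\<^bsub>P\<^esub>T))"

definition supp :: "('a, 'b) gorder_scheme \<Rightarrow> 'a \<Rightarrow> 'a set" where
  "supp P p = {a \<in> atoms P. a \<sqsubseteq>\<^bsub>P\<^esub> p}"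

definition join_sets :: "('a, 'b) gorder_scheme \<Rightarrow> 'a \<Rightarrow> 'a set set" where
  "join_sets P p = {T. T \<subseteq> supp P p \<and> \<Squnion>\<^bsub>P\<^esub>T = p}"

text \<open>
  ``Exactly two elements \<open>a, b\<close> of \<open>T\<close> with join \<open>p\<close>'' means that there is exactly one
  unordered pair of distinct elements of \<open>T\<close> whose join is \<open>p\<close>.
\<close>

definition super_atomic :: "('a, 'b) gorder_scheme \<Rightarrow> bool" where
  "super_atomic P \<longleftrightarrow> finite_atomic_lattice P \<and>
     (\<forall>p\<in>carrier P. p \<noteq> \<bottom>\<^bsub>P\<^esub> \<and> p \<notin> atoms P \<longrightarrow>
        (\<forall>T\<in>join_sets P p. \<exists>!D. \<exists>a\<in>T. \<exists>b\<in>T. a \<noteq> b \<and> D = {a, b} \<and> a \<squnion>\<^bsub>P\<^esub> b = p))"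

definition inclusion_order :: "'a set set \<Rightarrow> 'a set gorder" where
  "inclusion_order \<S> = \<lparr>carrier = \<S>, eq = (=), le = (\<subseteq>)\<rparr>"

definition labeled_atomic_lattices :: "nat \<Rightarrow> nat set set set" where
  "labeled_atomic_lattices n =
     {\<S>. \<S> \<subseteq> Pow {1..n} \<and> {} \<in> \<S> \<and> {1..n} \<in> \<S> \<and> (\<forall>i\<in>{1..n}. {i} \<in> \<S>) \<and>
          (\<forall>A\<in>\<S>. \<forall>B\<in>\<S>. A \<inter> B \<in> \<S>)}"

text \<open>
  \<open>procedure_state n k F \<S>\<close>: some run of the procedure on \<open>{1..n}\<close> reaches its stopping test with
  counter \<open>k\<close>, current level \<open>F\<close> (that is, \<open>S\<^sub>n\<^sub>-\<^sub>k\<close>) and accumulated family \<open>\<S>\<close>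
  (that is, \<open>S\<^sup>*\<close>). The functions \<open>i\<close> and \<open>j\<close> give the chosen pair \<open>\<delta>(S) = {i S, j S}\<close>.
\<close>

inductive procedure_state :: "nat \<Rightarrow> nat \<Rightarrow> nat set set \<Rightarrow> nat set set \<Rightarrow> bool" for n where
  start: "procedure_state n 0 {{1..n}} ({{}} \<union> (\<lambda>x. {x}) ` {1..n} \<union> {{1..n}})"
| step: "procedure_state n (k + 1) F' (\<S> \<union> F')"
    if "procedure_state n k F \<S>"
      and "n - k \<noteq> 2"
      and "\<forall>S\<in>F. i S \<in> S \<and> j S \<in> S \<and> i S \<noteq> j S \<and> (\<forall>T\<in>F - {S}. \<not> {i S, j S} \<subseteq> T)"
      and "F' = (\<Union>S\<in>F. {S - {i S}, S - {j S}})"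

definition procedure_output :: "nat \<Rightarrow> nat set set \<Rightarrow> bool" where
  "procedure_output n \<S> \<longleftrightarrow> (\<exists>k F. procedure_state n k F \<S> \<and> n - k = 2)"

end

theory Submission
  imports Defs
begin

text \<open>
  In a super-atomic family every member \<open>S\<close> with at least two elements is the closure of exactly
  one pair \<open>\<delta> S \<subseteq> S\<close>, and a subset of \<open>S\<close> generates \<open>S\<close> iff it contains \<open>\<delta> S\<close>. Hence removing
  an element of \<open>\<delta> S\<close> from \<open>S\<close> yields a closed set again, and \<open>\<delta> S\<close> lies in no other closed set of
  the same or smaller size. These two properties are equivalent to super-atomicity, even if closure
  under intersection is not assumed: for \<open>A \<subseteq> S\<close> with at least two elements, removing elements of
  \<open>\<delta> S\<close> outside \<open>A\<close> as long as possible ends in a member \<open>V\<close> with \<open>\<delta> V \<subseteq> A \<subseteq> V\<close>, which is the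
  closure of \<open>A\<close>. They are also exactly what the procedure guarantees, because if \<open>\<delta> S\<close> were
  contained in a smaller set, it would be contained in the ancestor of that set on the level of
  \<open>S\<close>, which has to be \<open>S\<close> itself.
\<close>

text \<open>Serves to transfer unique existence from pairs of points to pairs of atoms;
  \<open>f\<close> will be the image map of \<open>\<lambda>x. {x}\<close>.\<close>

lemma ex1_image_iff: "inj f \<Longrightarrow> (\<exists>!y. \<exists>x. y = f x \<and> P x) \<longleftrightarrow> (\<exists>!x. P x)"
  by (metis injD)

section \<open>Families with generating pairs\<close>

text \<open>
  The bound \<open>m\<close> serves unfinished runs of the procedure, in which the sets of the current level have
  not been assigned a pair yet; for complete families \<open>m = 2\<close>.
\<close>

definition generating_pairs :: "nat \<Rightarrow> 'a set set \<Rightarrow> ('a set \<Rightarrow> 'a set) \<Rightarrow> bool" where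
  "generating_pairs m \<S> \<delta> \<longleftrightarrow> (\<forall>S\<in>\<S>. m \<le> card S \<longrightarrow> \<delta> S \<subseteq> S \<and> card (\<delta> S) = 2 \<and>
     (\<forall>x\<in>\<delta> S. S - {x} \<in> \<S>) \<and> (\<forall>T\<in>\<S>. \<delta> S \<subseteq> T \<longrightarrow> card T \<le> card S \<longrightarrow> T = S))"

lemma generating_pairsD:
  assumes "generating_pairs m \<S> \<delta>" "S \<in> \<S>" "m \<le> card S"
  shows "\<delta> S \<subseteq> S" "card (\<delta> S) = 2" "\<And>x. x \<in> \<delta> S \<Longrightarrow> S - {x} \<in> \<S>"
    "\<And>T. T \<in> \<S> \<Longrightarrow> \<delta> S \<subseteq> T \<Longrightarrow> card T \<le> card S \<Longrightarrow> T = S"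
  using assms unfolding generating_pairs_def by blast+

text \<open>A smallest member \<open>V\<close> between \<open>A\<close> and \<open>S\<close> works:
  an element of \<open>\<delta> V\<close> outside \<open>A\<close> could be removed, leaving a
  smaller member between them.\<close>

lemma generating_pairs_descend:
  assumes gp: "generating_pairs 2 \<S> \<delta>" and S: "S \<in> \<S>" "finite S" "A \<subseteq> S" and A: "2 \<le> card A"
  obtains V where "V \<in> \<S>" "\<delta> V \<subseteq> A" "A \<subseteq> V" "V \<subseteq> S"
proof -
  let ?P = "\<lambda>V. V \<in> \<S> \<and> A \<subseteq> V \<and> V \<subseteq> S"
  have "?P S" using S by blast
  then obtain V where V: "?P V" and minimal: "\<And>W. ?P W \<Longrightarrow> card V \<le> card W"
    using ex_has_least_nat[of ?P S card] by blast
  have fin: "finite V" using V S finite_subset by blast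
  have card: "2 \<le> card V" using A V fin card_mono order_trans by blast
  have "\<delta> V \<subseteq> A"
  proof (rule ccontr)
    assume "\<not> \<delta> V \<subseteq> A"
    then obtain x where x: "x \<in> \<delta> V" "x \<notin> A" by blast
    have "?P (V - {x})" using generating_pairsD[OF gp _ card] V x by blast
    then have "card V \<le> card (V - {x})" by (rule minimal)
    moreover have "x \<in> V" using generating_pairsD(1)[OF gp _ card] V x by blast
    ultimately show False using fin by (meson card_Diff1_less leD)
  qed
  with V that show thesis by blast
qed

text \<open>Descending from \<open>S\<close> to \<open>\<delta> U\<close> yields \<open>V\<close>
  such that each of \<open>U\<close> and \<open>V\<close> contains the pair of the other. The
  uniqueness clause of the larger one then gives \<open>U = V\<close>.\<close>

lemma generating_pairs_subset:
  assumes gp: "generating_pairs 2 \<S> \<delta>" and U: "U \<in> \<S>" "2 \<le> card U"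
    and S: "S \<in> \<S>" "finite S" and sub: "\<delta> U \<subseteq> S"
  shows "U \<subseteq> S"
proof -
  note U' = generating_pairsD[OF gp U]
  obtain V where V: "V \<in> \<S>" "\<delta> V \<subseteq> \<delta> U" "\<delta> U \<subseteq> V" "V \<subseteq> S"
    using generating_pairs_descend[OF gp S sub] U'(2) by auto
  have "finite V" using V S finite_subset by blast
  then have card: "2 \<le> card V" using V U'(2) by (metis card_mono)
  note V' = generating_pairsD[OF gp V(1) card]
  have "U = V"
    using U'(4)[OF V(1) V(3)] V'(4)[OF U(1)] U'(1) V(2) by (metis nle_le order_trans)
  with V show ?thesis by blast
qed

text \<open>Let \<open>P\<close> be a smallest member properly containing \<open>S\<close> within
  \<open>X\<close>. Its pair cannot lie in the smaller set \<open>S\<close>; removing a point of the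
  pair outside \<open>S\<close> leaves a member containing \<open>S\<close>, which is
  \<open>S\<close> by minimality. This later shows that every set of a level arises from the level
  above.\<close>

lemma generating_pairs_parent:
  assumes gp: "generating_pairs 2 \<S> \<delta>" and S: "S \<in> \<S>" "2 \<le> card S"
    and X: "X \<in> \<S>" "finite X" "S \<subset> X"
  obtains P x where "P \<in> \<S>" "card P = card S + 1" "x \<in> \<delta> P" "S = P - {x}"
proof -
  let ?P = "\<lambda>V. V \<in> \<S> \<and> S \<subset> V \<and> V \<subseteq> X"
  have "?P X" using X by blast
  then obtain P where P: "?P P" and minimal: "\<And>W. ?P W \<Longrightarrow> card P \<le> card W"
    using ex_has_least_nat[of ?P X card] by blast
  have fin: "finite P" using P X finite_subset by blast
  have less: "card S < card P" using P fin psubset_card_mono by blast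
  then have card: "2 \<le> card P" using S by simp
  note P' = generating_pairsD[OF gp _ card]
  have "\<not> \<delta> P \<subseteq> S" using P'(4)[of S] P S less by auto
  then obtain x where x: "x \<in> \<delta> P" "x \<notin> S" by blast
  have xP: "x \<in> P" using P'(1) P x by blast
  have eq: "S = P - {x}"
  proof (rule ccontr)
    assume "S \<noteq> P - {x}"
    then have "?P (P - {x})" using P'(3) P x by blast
    then have "card P \<le> card (P - {x})" by (rule minimal)
    then show False using fin xP by (meson card_Diff1_less leD)
  qed
  moreover have "card P = card S + 1" using fin xP eq by (metis Suc_eq_plus1 card_Suc_Diff1)
  ultimately show thesis using that P x by blast
qed

section \<open>Closure\<close>

text \<open>Meant for \<open>A\<close> contained in some member; otherwise the empty intersection
  gives the whole type.\<close>

definition closure_in :: "'a set set \<Rightarrow> 'a set \<Rightarrow> 'a set" where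
  "closure_in \<S> A = \<Inter>{S \<in> \<S>. A \<subseteq> S}"

lemma closure_in_extensive: "A \<subseteq> closure_in \<S> A"
  unfolding closure_in_def by blast

lemma closure_in_least: "S \<in> \<S> \<Longrightarrow> A \<subseteq> S \<Longrightarrow> closure_in \<S> A \<subseteq> S"
  unfolding closure_in_def by blast

lemma closure_in_closed: "S \<in> \<S> \<Longrightarrow> closure_in \<S> S = S"
  unfolding closure_in_def by blast

text \<open>Closure under intersection is kept apart: for outputs of the procedure it has to be
  derived from the generating pairs.\<close>

locale pointed_family =
  fixes X :: "'a set" and \<S> :: "'a set set"
  assumes finite_X: "finite X" and subsets: "\<S> \<subseteq> Pow X"
    and empty: "{} \<in> \<S>" and top: "X \<in> \<S>" and singleton: "x \<in> X \<Longrightarrow> {x} \<in> \<S>"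
begin

lemma finite_member: "S \<in> \<S> \<Longrightarrow> finite S"
  using subsets finite_X finite_subset by blast

lemma card_le_1_cases:
  assumes "S \<subseteq> X" "\<not> 2 \<le> card S"
  shows "S = {} \<or> (\<exists>x\<in>X. S = {x})"
proof -
  have "finite S" using assms finite_X finite_subset by blast
  moreover have "card S = 0 \<or> card S = 1" using assms by linarith
  ultimately show ?thesis using assms(1) by (auto simp: card_1_singleton_iff)
qed

lemma small_member: "S \<subseteq> X \<Longrightarrow> \<not> 2 \<le> card S \<Longrightarrow> S \<in> \<S>"
  using card_le_1_cases empty singleton by blast

end

locale atomic_family = pointed_family +
  assumes Int: "A \<in> \<S> \<Longrightarrow> B \<in> \<S> \<Longrightarrow> A \<inter> B \<in> \<S>"
begin

lemma closure_in_member: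
  assumes "A \<subseteq> X"
  shows "closure_in \<S> A \<in> \<S>"
proof -
  have "\<Inter>\<F> \<in> \<S>" if "finite \<F>" "\<F> \<noteq> {}" "\<F> \<subseteq> \<S>" for \<F>
    using that by (induction rule: finite_ne_induct) (auto intro: Int)
  moreover have "finite \<S>" using subsets finite_X by (meson finite_Pow_iff finite_subset)
  moreover have "{S \<in> \<S>. A \<subseteq> S} \<noteq> {}" using top assms by blast
  ultimately show ?thesis unfolding closure_in_def by simp
qed

section \<open>The lattice of a family of sets\<close>

abbreviation L where "L \<equiv> inclusion_order \<S>"

lemma carrier_L: "carrier L = \<S>" and le_L: "x \<sqsubseteq>\<^bsub>L\<^esub> y \<longleftrightarrow> x \<subseteq> y" and eq_L: "x .=\<^bsub>L\<^esub> y \<longleftrightarrow> x = y"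
  by (simp_all add: inclusion_order_def)

text \<open>The upper bounds of \<open>T\<close> are the members containing
  \<open>\<Union>T\<close>. The equivalence includes uniqueness, which evaluates the choice operator
  in the definition of suprema.\<close>

lemma least_Upper_L:
  assumes "T \<subseteq> \<S>"
  shows "least L M (Upper L T) \<longleftrightarrow> M = closure_in \<S> (\<Union>T)"
proof -
  have Upper: "Upper L T = {S \<in> \<S>. \<Union>T \<subseteq> S}"
    using assms unfolding Upper_def carrier_L le_L by blast
  have member: "closure_in \<S> (\<Union>T) \<in> Upper L T"
    using closure_in_member[of "\<Union>T"] assms subsets closure_in_extensive[of "\<Union>T" \<S>]
    unfolding Upper by auto
  have lower: "closure_in \<S> (\<Union>T) \<subseteq> S" if "S \<in> Upper L T" for S
    using that closure_in_least[of S \<S> "\<Union>T"] unfolding Upper by simp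
  have "Upper L T \<subseteq> \<S>" unfolding Upper by simp
  then show ?thesis
    unfolding least_def le_L carrier_L using member lower by (metis subset_antisym)
qed

lemma sup_L: "T \<subseteq> \<S> \<Longrightarrow> \<Squnion>\<^bsub>L\<^esub>T = closure_in \<S> (\<Union>T)"
  unfolding Lattice.sup_def by (simp add: least_Upper_L)

lemma join_L: "a \<in> \<S> \<Longrightarrow> b \<in> \<S> \<Longrightarrow> a \<squnion>\<^bsub>L\<^esub> b = closure_in \<S> (a \<union> b)"
  unfolding join_def by (simp add: sup_L)

lemma greatest_Lower_L:
  assumes "a \<in> \<S>" "b \<in> \<S>"
  shows "greatest L (a \<inter> b) (Lower L {a, b})"
  using assms Int unfolding greatest_def Lower_def carrier_L le_L by auto

lemma least_L: "least L x \<S> \<longleftrightarrow> x = {}"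
  using empty unfolding least_def le_L carrier_L by blast

lemma bottom_L: "\<bottom>\<^bsub>L\<^esub> = {}"
  unfolding bottom_def carrier_L least_L by simp

lemma atoms_L: "atoms L = (\<lambda>x. {x}) ` X"
proof
  show "atoms L \<subseteq> (\<lambda>x. {x}) ` X"
  proof
    fix a assume "a \<in> atoms L"
    then have a: "a \<in> \<S>" "a \<noteq> {}" "\<And>x. x \<in> \<S> \<Longrightarrow> x \<subseteq> a \<Longrightarrow> x = {} \<or> x = a"
      unfolding atoms_def bottom_L carrier_L le_L by auto
    then obtain x where "x \<in> a" by blast
    moreover from this have "x \<in> X" using a subsets by blast
    ultimately show "a \<in> (\<lambda>x. {x}) ` X" using a(3)[OF singleton] by blast
  qed
  show "(\<lambda>x. {x}) ` X \<subseteq> atoms L"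
    unfolding atoms_def bottom_L carrier_L le_L using singleton by auto
qed

lemma finite_atomic_lattice_L: "finite_atomic_lattice L"
proof -
  have "Lattice.bounded_lattice L"
  proof unfold_locales
    show "\<exists>x. greatest L x (carrier L)"
      using top subsets unfolding greatest_def carrier_L le_L by blast
    show "\<exists>x. least L x (carrier L)"
      by (simp add: carrier_L least_L)
  next
    fix x y assume "x \<in> carrier L" "y \<in> carrier L"
    then have xy: "x \<in> \<S>" "y \<in> \<S>" by (simp_all add: carrier_L)
    then show "\<exists>s. least L s (Upper L {x, y})" using least_Upper_L[of "{x, y}"] by blast
    show "\<exists>s. greatest L s (Lower L {x, y})" using greatest_Lower_L[OF xy] by blast
  qed (auto simp: carrier_L le_L eq_L fun_eq_iff)
  moreover have "finite (carrier L)"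
    unfolding carrier_L using subsets finite_X by (meson finite_Pow_iff finite_subset)
  moreover have "\<exists>T\<subseteq>atoms L. p = \<Squnion>\<^bsub>L\<^esub>T" if "p \<in> carrier L" for p
  proof (intro exI conjI)
    have p: "p \<in> \<S>" "p \<subseteq> X" using that subsets unfolding carrier_L by auto
    show "(\<lambda>x. {x}) ` p \<subseteq> atoms L" using p unfolding atoms_L by blast
    have "(\<lambda>x. {x}) ` p \<subseteq> \<S>" using p singleton by blast
    then show "p = \<Squnion>\<^bsub>L\<^esub>((\<lambda>x. {x}) ` p)"
      by (simp add: sup_L closure_in_closed p)
  qed
  ultimately show ?thesis unfolding finite_atomic_lattice_def by blast
qed

text \<open>Sets of atoms below \<open>p\<close> correspond to subsets of \<open>p\<close> via
  singletons, and joins become closures.\<close>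

lemma join_sets_L:
  assumes "p \<in> \<S>"
  shows "join_sets L p = (`) (\<lambda>x. {x}) ` {A. A \<subseteq> p \<and> closure_in \<S> A = p}"
proof -
  have p: "p \<subseteq> X" using assms subsets by blast
  have supp: "supp L p = (\<lambda>x. {x}) ` p"
    using p unfolding supp_def atoms_L le_L by blast
  have "\<Squnion>\<^bsub>L\<^esub>((\<lambda>x. {x}) ` A) = closure_in \<S> A" if "A \<subseteq> p" for A
  proof -
    have "(\<lambda>x. {x}) ` A \<subseteq> \<S>" using that p singleton by blast
    then show ?thesis by (simp add: sup_L)
  qed
  then show ?thesis
    unfolding join_sets_def supp by (auto simp: subset_image_iff)
qed

text \<open>Atoms are replaced by points: members other than the bottom and the atoms are those with
  at least two elements, and two-element sets of atoms are images of two-element sets of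
  points.\<close>

lemma super_atomic_L:
  "super_atomic L \<longleftrightarrow> (\<forall>S\<in>\<S>. 2 \<le> card S \<longrightarrow>
     (\<forall>A\<subseteq>S. closure_in \<S> A = S \<longrightarrow> (\<exists>!D. D \<subseteq> A \<and> card D = 2 \<and> closure_in \<S> D = S)))"
proof -
  have large: "p \<noteq> \<bottom>\<^bsub>L\<^esub> \<and> p \<notin> atoms L \<longleftrightarrow> 2 \<le> card p" if "p \<in> \<S>" for p
    using card_le_1_cases[of p] that subsets unfolding bottom_L atoms_L by auto
  have pairs: "(\<exists>!D. \<exists>a\<in>(\<lambda>x. {x}) ` A. \<exists>b\<in>(\<lambda>x. {x}) ` A. a \<noteq> b \<and> D = {a, b} \<and> a \<squnion>\<^bsub>L\<^esub> b = p)
      \<longleftrightarrow> (\<exists>!D. D \<subseteq> A \<and> card D = 2 \<and> closure_in \<S> D = p)" (is "(\<exists>!D. ?Q D) \<longleftrightarrow> (\<exists>!D. ?R D)")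
    if A: "A \<subseteq> X" for A p
  proof -
    have "?Q D \<longleftrightarrow> (\<exists>E. D = (\<lambda>x. {x}) ` E \<and> ?R E)" for D
    proof
      assume "?Q D"
      then obtain x y where xy: "x \<in> A" "y \<in> A" "x \<noteq> y" "D = {{x}, {y}}" "{x} \<squnion>\<^bsub>L\<^esub> {y} = p"
        by blast
      then have "closure_in \<S> {x, y} = p"
        using A singleton join_L[of "{x}" "{y}"] by (auto simp: insert_commute)
      then show "\<exists>E. D = (\<lambda>x. {x}) ` E \<and> ?R E"
        using xy by (intro exI[of _ "{x, y}"]) auto
    next
      assume "\<exists>E. D = (\<lambda>x. {x}) ` E \<and> ?R E"
      then obtain x y where xy: "x \<in> A" "y \<in> A" "x \<noteq> y" "D = {{x}, {y}}" "closure_in \<S> {x, y} = p"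
        by (auto simp: card_2_iff)
      then have join: "{x} \<squnion>\<^bsub>L\<^esub> {y} = p"
        using A singleton join_L[of "{x}" "{y}"] by (auto simp: insert_commute)
      show "?Q D"
      proof (intro bexI conjI)
        show "{x} \<noteq> {y}" "D = {{x}, {y}}" "{x} \<squnion>\<^bsub>L\<^esub> {y} = p" using xy join by simp_all
        show "{y} \<in> (\<lambda>x. {x}) ` A" "{x} \<in> (\<lambda>x. {x}) ` A" using xy by simp_all
      qed
    qed
    moreover have "inj ((`) (\<lambda>x::'a. {x}))" by (simp add: inj_def inj_image_eq_iff)
    ultimately show ?thesis by (simp only: ex1_image_iff)
  qed
  have body: "(\<forall>T\<in>join_sets L p. \<exists>!D. \<exists>a\<in>T. \<exists>b\<in>T. a \<noteq> b \<and> D = {a, b} \<and> a \<squnion>\<^bsub>L\<^esub> b = p) \<longleftrightarrow>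
      (\<forall>A\<subseteq>p. closure_in \<S> A = p \<longrightarrow> (\<exists>!D. D \<subseteq> A \<and> card D = 2 \<and> closure_in \<S> D = p))"
    if "p \<in> \<S>" for p
  proof -
    have "A \<subseteq> X" if "A \<subseteq> p" for A using that \<open>p \<in> \<S>\<close> subsets by blast
    then show ?thesis
      unfolding join_sets_L[OF that] by (simp only: ball_simps mem_Collect_eq) (simp only: pairs imp_conjL cong: imp_cong)
  qed
  show ?thesis
    unfolding super_atomic_def carrier_L using finite_atomic_lattice_L
    by (simp only: simp_thms large body cong: ball_cong)
qed

section \<open>Super-atomicity and generating pairs\<close>

lemma generating_pairs_if_super_atomic:
  assumes "super_atomic L"
  obtains \<delta> where "generating_pairs 2 \<S> \<delta>"
proof
  \<comment> \<open>Well defined for members with at least two elements: such an \<open>S\<close> is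
    its own closure, so super-atomicity applies to \<open>S\<close> as a generating set.\<close>
  define \<delta> where "\<delta> S = (THE D. D \<subseteq> S \<and> card D = 2 \<and> closure_in \<S> D = S)" for S
  show "generating_pairs 2 \<S> \<delta>"
    unfolding generating_pairs_def
  proof (intro ballI impI)
    fix S assume S: "S \<in> \<S>" "2 \<le> card S"
    have ex1: "\<exists>!D. D \<subseteq> A \<and> card D = 2 \<and> closure_in \<S> D = S"
      if "A \<subseteq> S" "closure_in \<S> A = S" for A
      by (rule assms[unfolded super_atomic_L, rule_format, OF S that])
    have \<delta>: "\<delta> S \<subseteq> S" "card (\<delta> S) = 2" "closure_in \<S> (\<delta> S) = S"
      using theI'[OF ex1[OF subset_refl closure_in_closed[OF S(1)]]] unfolding \<delta>_def by auto
    \<comment> \<open>The unique pair inside \<open>A\<close> that generates \<open>S\<close> is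
      also such a pair inside \<open>S\<close>, hence equals \<open>\<delta> S\<close>.\<close>
    have spanning: "\<delta> S \<subseteq> A" if "A \<subseteq> S" "closure_in \<S> A = S" for A
      using ex1[OF that] ex1[OF subset_refl closure_in_closed[OF S(1)]] \<delta> that(1)
      by (metis order_trans)
    have "S - {x} \<in> \<S>" if "x \<in> \<delta> S" for x
    proof -
      \<comment> \<open>Without \<open>x\<close> the set misses part of \<open>\<delta> S\<close>,
        so its closure is a proper subset of \<open>S\<close> and cannot add the only missing
        point.\<close>
      have "closure_in \<S> (S - {x}) \<noteq> S" using spanning[of "S - {x}"] that by blast
      moreover have "closure_in \<S> (S - {x}) \<subseteq> S" using S(1) by (simp add: closure_in_least)
      ultimately have "closure_in \<S> (S - {x}) = S - {x}"
        using closure_in_extensive[of "S - {x}" \<S>] by blast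
      moreover have "S - {x} \<subseteq> X" using S(1) subsets by blast
      ultimately show ?thesis using closure_in_member by metis
    qed
    moreover have "T = S" if "T \<in> \<S>" "\<delta> S \<subseteq> T" "card T \<le> card S" for T
    proof -
      have "S \<subseteq> T" using closure_in_least[OF that(1,2)] \<delta> by simp
      then show ?thesis using that finite_member card_seteq by metis
    qed
    ultimately show "\<delta> S \<subseteq> S \<and> card (\<delta> S) = 2 \<and> (\<forall>x\<in>\<delta> S. S - {x} \<in> \<S>) \<and>
        (\<forall>T\<in>\<S>. \<delta> S \<subseteq> T \<longrightarrow> card T \<le> card S \<longrightarrow> T = S)"
      using \<delta> by blast
  qed
qed

lemma super_atomic_if_generating_pairs:
  assumes gp: "generating_pairs 2 \<S> \<delta>"
  shows "super_atomic L"
  unfolding super_atomic_L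
proof (intro ballI allI impI)
  fix S A assume S: "S \<in> \<S>" "2 \<le> card S" and A: "A \<subseteq> S" "closure_in \<S> A = S"
  note S' = generating_pairsD[OF gp S]
  have spanning: "\<delta> S \<subseteq> B" if B: "B \<subseteq> S" "closure_in \<S> B = S" for B
  proof -
    have "B \<subseteq> X" using B S subsets by blast
    \<comment> \<open>With fewer than two points, \<open>B\<close> would be a member, hence its own
      closure, and could not generate \<open>S\<close>.\<close>
    then have "2 \<le> card B"
      using small_member[of B] closure_in_closed[of B \<S>] B S by metis
    then obtain V where V: "V \<in> \<S>" "\<delta> V \<subseteq> B" "B \<subseteq> V" "V \<subseteq> S"
      using generating_pairs_descend[OF gp S(1) finite_member[OF S(1)] B(1)] by blast
    then have "V = S" using closure_in_least[of V \<S> B] B(2) by blast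
    then show ?thesis using V(2) by simp
  qed
  show "\<exists>!D. D \<subseteq> A \<and> card D = 2 \<and> closure_in \<S> D = S"
  proof (intro ex1I conjI)
    show "\<delta> S \<subseteq> A" by (rule spanning[OF A])
    show "card (\<delta> S) = 2" by (rule S')
    have "S \<subseteq> closure_in \<S> (\<delta> S)"
      unfolding closure_in_def using generating_pairs_subset[OF gp S] finite_member by blast
    then show "closure_in \<S> (\<delta> S) = S" using closure_in_least[OF S(1) S'(1)] by blast
  next
    fix D assume D: "D \<subseteq> A \<and> card D = 2 \<and> closure_in \<S> D = S"
    then have "\<delta> S \<subseteq> D" using spanning A by blast
    moreover have "finite D" using D card.infinite by fastforce
    ultimately show "D = \<delta> S" using D S'(2) card_subset_eq by metis
  qed
qed

end

text \<open>The descent from \<open>S\<close> to \<open>S \<inter> T\<close> ends in a member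
  \<open>U\<close> whose pair lies in both sets, so \<open>U\<close> lies in both and equals the
  intersection. An intersection with fewer than two points is a member anyway.\<close>

lemma (in pointed_family) generating_pairs_Int:
  assumes gp: "generating_pairs 2 \<S> \<delta>" and S: "S \<in> \<S>" and T: "T \<in> \<S>"
  shows "S \<inter> T \<in> \<S>"
proof (cases "2 \<le> card (S \<inter> T)")
  case True
  then obtain U where U: "U \<in> \<S>" "\<delta> U \<subseteq> S \<inter> T" "S \<inter> T \<subseteq> U"
    using generating_pairs_descend[OF gp S finite_member[OF S]] by (metis inf_le1)
  then have "2 \<le> card U" using True finite_member card_mono order_trans by metis
  then have "U \<subseteq> S" "U \<subseteq> T"
    using generating_pairs_subset[OF gp] U S T finite_member by auto
  then show ?thesis using U by (metis Int_subset_iff subset_antisym)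
next
  case False
  then show ?thesis using small_member S subsets by blast
qed

section \<open>Runs of the procedure\<close>

text \<open>The loop invariant. Its pairs concern only sets above the current level, which has not
  chosen yet; the gap between the singletons and the current level ensures that no old set has the
  size of the next level.\<close>

lemma procedure_state_pairs:
  assumes "procedure_state n k F \<S>" "n \<ge> 2"
  shows "k + 2 \<le> n \<and> pointed_family {1..n} \<S> \<and> F = {S \<in> \<S>. card S = n - k} \<and>
    (\<forall>S\<in>\<S>. 2 \<le> card S \<longrightarrow> n - k \<le> card S) \<and>
    (\<exists>\<delta>. generating_pairs (n - k + 1) \<S> \<delta>)"
  using assms
proof (induction rule: procedure_state.induct)
  case start
  let ?\<S> = "{{}} \<union> (\<lambda>x. {x}) ` {1..n} \<union> {{1..n}}"
  have pf: "pointed_family {1..n} ?\<S>"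
    by unfold_locales auto
  have card: "S = {1..n} \<or> card S < 2" if "S \<in> ?\<S>" for S
    using that by auto
  have "{{1..n}} = {S \<in> ?\<S>. card S = n - 0}"
    using card start by fastforce
  moreover have "n - 0 \<le> card S" if "S \<in> ?\<S>" "2 \<le> card S" for S
    using card[OF that(1)] that(2) by auto
  \<comment> \<open>Vacuous for any \<open>\<delta>\<close>: no member has more than
    \<open>n\<close> elements.\<close>
  moreover have "generating_pairs (n - 0 + 1) ?\<S> \<delta>" for \<delta>
    unfolding generating_pairs_def
  proof (intro ballI impI)
    fix S assume "S \<in> ?\<S>" "n - 0 + 1 \<le> card S"
    with card[of S] start have False by auto
    then show "\<delta> S \<subseteq> S \<and> card (\<delta> S) = 2 \<and> (\<forall>x\<in>\<delta> S. S - {x} \<in> ?\<S>) \<and>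
        (\<forall>T\<in>?\<S>. \<delta> S \<subseteq> T \<longrightarrow> card T \<le> card S \<longrightarrow> T = S)" ..
  qed
  ultimately show ?case using pf start by (intro conjI) (simp, blast+)
next
  case (step k F \<S> i j F')
  then have k: "k + 2 < n" and F: "F = {S \<in> \<S>. card S = n - k}"
    and large: "\<And>S. S \<in> \<S> \<Longrightarrow> 2 \<le> card S \<Longrightarrow> n - k \<le> card S"
    and "pointed_family {1..n} \<S>" by auto
  interpret pointed_family "{1..n}" \<S> by fact
  obtain \<delta> where gp: "generating_pairs (n - k + 1) \<S> \<delta>"
    using step by blast
  note ij = step.hyps(3)[rule_format] and F' = step.hyps(4)
  \<comment> \<open>The current level takes its chosen pairs, the levels above keep theirs.\<close>
  define \<epsilon> where "\<epsilon> S = (if S \<in> F then {i S, j S} else \<delta> S)" for S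
  have child: "\<exists>P\<in>F. \<exists>x\<in>\<epsilon> P. x \<in> P \<and> T = P - {x}" if "T \<in> F'" for T
    using that ij unfolding F' \<epsilon>_def by auto
  have card_F': "card T = n - (k + 1)" if T: "T \<in> F'" for T
  proof -
    obtain P x where "P \<in> F" "x \<in> P" "T = P - {x}" using child[OF T] by blast
    then show ?thesis by (simp add: F)
  qed
  have "F' \<subseteq> Pow {1..n}" using child F subsets by blast
  then have "pointed_family {1..n} (\<S> \<union> F')"
    by unfold_locales (use subsets empty top singleton in auto)
  moreover have "F' = {S \<in> \<S> \<union> F'. card S = n - (k + 1)}"
  proof -
    have "card S \<noteq> n - (k + 1)" if "S \<in> \<S>" for S using large[OF that] k by linarith
    then show ?thesis using card_F' by blast
  qed
  moreover have "n - (k + 1) \<le> card S" if "S \<in> \<S> \<union> F'" "2 \<le> card S" for S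
    using that large[of S] card_F'[of S] by auto
  moreover have "generating_pairs (n - (k + 1) + 1) (\<S> \<union> F') \<epsilon>"
    unfolding generating_pairs_def
  proof (intro ballI impI)
    fix S assume S: "S \<in> \<S> \<union> F'" "n - (k + 1) + 1 \<le> card S"
    \<comment> \<open>The new level lies one below the bound, so only old sets need pairs.\<close>
    have SS: "S \<in> \<S>" using S card_F'[of S] by auto
    have ge: "n - k \<le> card S" using large[OF SS] S(2) k by linarith
    have eps: "\<epsilon> S \<subseteq> S \<and> card (\<epsilon> S) = 2 \<and> (\<forall>x\<in>\<epsilon> S. S - {x} \<in> \<S> \<union> F')"
    proof (cases "S \<in> F")
      case True
      then show ?thesis using ij[OF True] F' unfolding \<epsilon>_def by auto
    next
      case False
      then have "n - k + 1 \<le> card S" using ge SS F by auto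
      note S' = generating_pairsD[OF gp SS this]
      from False show ?thesis using S' unfolding \<epsilon>_def by auto
    qed
    \<comment> \<open>For \<open>S\<close> on the current level, the gap below forces
      \<open>T\<close> onto the same level, where the condition on the choice applies; higher up,
      the induction hypothesis applies.\<close>
    have old: "T = S" if T: "T \<in> \<S>" "\<epsilon> S \<subseteq> T" "card T \<le> card S" for T
    proof (cases "S \<in> F")
      case True
      have "2 \<le> card T" using eps T finite_member card_mono by metis
      then have "T \<in> F" using large[OF T(1)] T True F by auto
      then show ?thesis using ij[OF True] T(2) True unfolding \<epsilon>_def by auto
    next
      case False
      then have "n - k + 1 \<le> card S" using ge SS F by auto
      note S' = generating_pairsD(4)[OF gp SS this]
      from False show ?thesis using S'[OF T(1)] T unfolding \<epsilon>_def by auto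
    qed
    \<comment> \<open>If a new set contained \<open>\<epsilon> S\<close>, so would its parent
      \<open>P\<close>, which is no larger than \<open>S\<close>; then \<open>P = S\<close>, but an
      element of \<open>\<epsilon> P\<close> has been removed.\<close>
    have new: "\<not> \<epsilon> S \<subseteq> T" if T: "T \<in> F'" for T
    proof
      assume sub: "\<epsilon> S \<subseteq> T"
      obtain P x where P: "P \<in> F" "x \<in> \<epsilon> P" "T = P - {x}" using child[OF T] by blast
      then have "P = S" using old[of P] sub F ge by auto
      then show False using P sub by blast
    qed
    show "\<epsilon> S \<subseteq> S \<and> card (\<epsilon> S) = 2 \<and> (\<forall>x\<in>\<epsilon> S. S - {x} \<in> \<S> \<union> F') \<and>
        (\<forall>T\<in>\<S> \<union> F'. \<epsilon> S \<subseteq> T \<longrightarrow> card T \<le> card S \<longrightarrow> T = S)"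
      using eps old new by blast
  qed
  ultimately show ?case using k by (intro conjI) (simp, blast+)
qed

text \<open>The run stops before the two-element sets choose pairs. Each of them serves as its own
  pair: removing a point leaves a singleton, and no other member of at most two elements contains
  it.\<close>

lemma generating_pairs_if_procedure_output:
  assumes "procedure_output n \<S>" "n \<ge> 2"
  shows "pointed_family {1..n} \<S>" "\<exists>\<delta>. generating_pairs 2 \<S> \<delta>"
proof -
  obtain k F where state: "procedure_state n k F \<S>" and k: "n - k = 2"
    using assms unfolding procedure_output_def by blast
  from procedure_state_pairs[OF state assms(2)] show "pointed_family {1..n} \<S>" by blast
  then interpret pointed_family "{1..n}" \<S> .
  obtain \<delta> where \<delta>: "generating_pairs (2 + 1) \<S> \<delta>"
    using procedure_state_pairs[OF state assms(2)] unfolding k by blast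
  have pair: "(\<forall>x\<in>S. S - {x} \<in> \<S>) \<and> (\<forall>T\<in>\<S>. S \<subseteq> T \<longrightarrow> card T \<le> card S \<longrightarrow> T = S)"
    if "S \<in> \<S>" "card S = 2" for S
  proof (intro conjI ballI impI)
    fix x assume "x \<in> S"
    then show "S - {x} \<in> \<S>" using that subsets by (intro small_member) auto
  next
    fix T assume "T \<in> \<S>" "S \<subseteq> T" "card T \<le> card S"
    then show "T = S" using finite_member card_seteq by metis
  qed
  have "generating_pairs 2 \<S> (\<lambda>S. if card S = 2 then S else \<delta> S)"
    unfolding generating_pairs_def
  proof (intro ballI impI)
    fix S assume "S \<in> \<S>" "2 \<le> card S"
    then show "(if card S = 2 then S else \<delta> S) \<subseteq> S \<and> card (if card S = 2 then S else \<delta> S) = 2 \<and>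
        (\<forall>x\<in>if card S = 2 then S else \<delta> S. S - {x} \<in> \<S>) \<and>
        (\<forall>T\<in>\<S>. (if card S = 2 then S else \<delta> S) \<subseteq> T \<longrightarrow> card T \<le> card S \<longrightarrow> T = S)"
      using pair[of S] \<delta> unfolding generating_pairs_def by (cases "card S = 2") simp_all
  qed
  then show "\<exists>\<delta>. generating_pairs 2 \<S> \<delta>" by blast
qed

section \<open>Recovering a family with generating pairs by a run\<close>

lemma procedure_output_if_generating_pairs:
  assumes "pointed_family {1..n} \<S>" and gp: "generating_pairs 2 \<S> \<delta>" and n: "n \<ge> 2"
  shows "procedure_output n \<S>"
proof -
  interpret pointed_family "{1..n}" \<S> by fact
  \<comment> \<open>The accumulated family expected at counter \<open>k\<close>.\<close>
  define levels where
    "levels k = {{}} \<union> (\<lambda>x. {x}) ` {1..n} \<union> {S \<in> \<S>. n - k \<le> card S}" for k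
  have full: "S = {1..n}" if "S \<in> \<S>" "n \<le> card S" for S
    using card_seteq[of "{1..n}" S] that subsets by auto
  obtain i j where ij: "\<And>S. S \<in> \<S> \<Longrightarrow> 2 \<le> card S \<Longrightarrow> i S \<noteq> j S \<and> \<delta> S = {i S, j S}"
    using generating_pairsD(2)[OF gp] unfolding card_2_iff by metis
  have "procedure_state n k {S \<in> \<S>. card S = n - k} (levels k)" if "k + 2 \<le> n" for k
    using that
  proof (induction k)
    case 0
    have "S \<in> \<S> \<and> card S = n - 0 \<longleftrightarrow> S = {1..n}" "S \<in> \<S> \<and> n - 0 \<le> card S \<longleftrightarrow> S = {1..n}" for S
      using full[of S] top by auto
    then show ?case using procedure_state.start[of n] unfolding levels_def by simp
  next
    case (Suc k)
    let ?F = "{S \<in> \<S>. card S = n - k}" and ?F' = "{S \<in> \<S>. card S = n - Suc k}"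
    \<comment> \<open>For sets of equal size, the uniqueness clause of
      \<open>generating_pairs\<close> is the condition on the choice.\<close>
    have choice: "\<forall>S\<in>?F. i S \<in> S \<and> j S \<in> S \<and> i S \<noteq> j S \<and> (\<forall>T\<in>?F - {S}. \<not> {i S, j S} \<subseteq> T)"
    proof
      fix S assume S: "S \<in> ?F"
      then have SS: "S \<in> \<S>" "2 \<le> card S" using Suc.prems by auto
      have "\<not> \<delta> S \<subseteq> T" if "T \<in> ?F - {S}" for T
        using generating_pairsD(4)[OF gp SS, of T] that S by auto
      then show "i S \<in> S \<and> j S \<in> S \<and> i S \<noteq> j S \<and> (\<forall>T\<in>?F - {S}. \<not> {i S, j S} \<subseteq> T)"
        using generating_pairsD(1)[OF gp SS] ij[OF SS] by simp
    qed
    have "?F' = (\<Union>S\<in>?F. {S - {i S}, S - {j S}})"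
    proof
      show "(\<Union>S\<in>?F. {S - {i S}, S - {j S}}) \<subseteq> ?F'"
      proof
        fix T assume "T \<in> (\<Union>S\<in>?F. {S - {i S}, S - {j S}})"
        then obtain S x where S: "S \<in> ?F" "x = i S \<or> x = j S" "T = S - {x}" by blast
        then have SS: "S \<in> \<S>" "2 \<le> card S" using Suc.prems by auto
        then have x: "x \<in> \<delta> S" using ij S(2) by auto
        then have "x \<in> S" using generating_pairsD(1)[OF gp SS] by blast
        then show "T \<in> ?F'"
          using generating_pairsD(3)[OF gp SS x] S by simp
      qed
      \<comment> \<open>A member of the lower level is a proper subset of \<open>{1..n}\<close>, so
        it has a parent with one more element, which lies in the current level.\<close>
      show "?F' \<subseteq> (\<Union>S\<in>?F. {S - {i S}, S - {j S}})"
      proof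
        fix S assume S: "S \<in> ?F'"
        have SS: "S \<in> \<S>" "2 \<le> card S" using S Suc.prems by auto
        have "S \<noteq> {1..n}" using S Suc.prems by auto
        then have "S \<subset> {1..n}" using SS subsets by blast
        then obtain P x where P: "P \<in> \<S>" "card P = card S + 1" "x \<in> \<delta> P" "S = P - {x}"
          using generating_pairs_parent[OF gp SS top finite_X] by blast
        have "P \<in> ?F" using P S Suc.prems by auto
        moreover have "x = i P \<or> x = j P" using ij[of P] P(1-3) SS(2) by auto
        ultimately show "S \<in> (\<Union>S\<in>?F. {S - {i S}, S - {j S}})" using P(4) by blast
      qed
    qed
    moreover have "levels (Suc k) = levels k \<union> ?F'"
    proof -
      \<comment> \<open>Since \<open>k < n\<close>, the truncated subtraction lowers the bound by
        exactly one.\<close>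
      have "n - Suc k \<le> c \<longleftrightarrow> n - k \<le> c \<or> c = n - Suc k" for c using Suc.prems by linarith
      then show ?thesis unfolding levels_def by blast
    qed
    ultimately show ?case
      using procedure_state.step[OF Suc.IH _ choice, of ?F'] Suc.prems by simp
  qed
  from this[of "n - 2"] have "procedure_state n (n - 2) {S \<in> \<S>. card S = 2} (levels (n - 2))"
    using n by simp
  moreover have "levels (n - 2) = \<S>"
  proof -
    \<comment> \<open>The bound is now 2, and members below it are empty or singletons.\<close>
    have "S \<in> levels (n - 2)" if "S \<in> \<S>" for S
      using card_le_1_cases[of S] that subsets n unfolding levels_def by auto
    then show ?thesis using empty singleton unfolding levels_def by auto
  qed
  ultimately show ?thesis unfolding procedure_output_def using n
    by (metis diff_diff_cancel)
qed

lemma labeled_atomic_lattices_iff: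
  "\<S> \<in> labeled_atomic_lattices n \<longleftrightarrow> atomic_family {1..n} \<S>"
  unfolding labeled_atomic_lattices_def atomic_family_def pointed_family_def
    atomic_family_axioms_def by auto

theorem theorem4p2:
  fixes n :: nat
  assumes "n \<ge> 2"
  shows "(\<forall>\<S>. procedure_output n \<S> \<longrightarrow>
            \<S> \<in> labeled_atomic_lattices n \<and> super_atomic (inclusion_order \<S>)) \<and>
         (\<forall>\<S>. \<S> \<in> labeled_atomic_lattices n \<and> super_atomic (inclusion_order \<S>) \<longrightarrow>
            procedure_output n \<S>)"
proof (intro conjI allI impI)
  fix \<S> assume out: "procedure_output n \<S>"
  then obtain \<delta> where gp: "generating_pairs 2 \<S> \<delta>"
    using generating_pairs_if_procedure_output(2) assms by blast
  interpret pointed_family "{1..n}" \<S>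
    using out assms by (rule generating_pairs_if_procedure_output(1))
  \<comment> \<open>The lattice results require closure under intersection, which the generating
    pairs supply.\<close>
  interpret atomic_family "{1..n}" \<S>
    by unfold_locales (rule generating_pairs_Int[OF gp])
  show "\<S> \<in> labeled_atomic_lattices n"
    unfolding labeled_atomic_lattices_iff by (rule atomic_family_axioms)
  show "super_atomic (inclusion_order \<S>)"
    by (rule super_atomic_if_generating_pairs[OF gp])
next
  fix \<S> assume \<S>: "\<S> \<in> labeled_atomic_lattices n \<and> super_atomic (inclusion_order \<S>)"
  then interpret atomic_family "{1..n}" \<S> by (simp add: labeled_atomic_lattices_iff)
  obtain \<delta> where "generating_pairs 2 \<S> \<delta>"
    using generating_pairs_if_super_atomic \<S> by blast
  then show "procedure_output n \<S>"
    using procedure_output_if_generating_pairs pointed_family_axioms assms by blast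
qed

end
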